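(* Let $G=(V,E)$ be an undirected graph, let $F$ be the relaxed encoding of $G$, and let $\psi$ be a smooth $\mathsf{PROB}$ representing $F$ with branch parameters $\theta_{hi}(n),\theta_{lo}(n)$. Consider the procedure that samples an assignment $\tau\in\mathsf{Sol}(F)$ with $\mathsf{ProbSample}$ on $\psi$ and outputs the trip $\mathcal{M}'(\tau)$. Given $v_s,v_t\in V$, let $\pi_{s,t}$ be a simple trip in $G$ between $v_s$ and $v_t$, and let $R_{\pi_{s,t}}=\{\tau\mid \tau\in\mathsf{Sol}(F)\text{ and }\mathcal{M}'(\tau)=\pi_{s,t}\}$. Then $$\Pr[\pi_{s,t}\text{ is sampled}]\ \propto\ \sum_{\tau\in R_{\pi_{s,t}}}\ \prod_{n\in\mathsf{Rep}_\psi(\tau)}\big[(1-I_n)\,\theta_{lo}(n)+I_n\,\theta_{hi}(n)\big],$$ where the product ranges over decision nodes $n$ in $\mathsf{Rep}_\psi(\tau)$ and $I_n=1$ if $hi(n)\in\mathsf{Rep}_\psi(\tau)$ and $0$ otherwise.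
   Context: Graphs and trips: for an undirected graph $G=(V,E)$, $N(v)=adj(v)$ is the set of neighbours of $v$. A path is a sequence of vertices $v_1,\dots,v_m$ with $v_{i+1}\in N(v_i)$; it is simple if its vertices are pairwise distinct; a simple path is a simple trip if no vertex of the path has three distinct neighbours that all lie on the path. $\mathsf{Term}(\pi)$ denotes the terminal (end) vertices of a path $\pi$. Relaxed encoding: for each $i\in V$ there are Boolean variables $n_i$ ("$i$ is on the trip") and $s_i$ ("$i$ is a terminal vertex"). $F$ is the conjunction of: (H1) $\bigvee_{i\in V}s_i$; (H2) for each $i$, $n_i\to\bigvee_{j\in adj(i)}n_j$; (H3) for all pairwise distinct $i,j,k\in V$, $\neg s_i\vee\neg s_j\vee\neg s_k$; (H4) for each $i$, $s_i\to\big(n_i\wedge\bigwedge_{j,k\in adj(i),\,j\ne k}(\neg n_j\vee\neg n_k)\big)$; (H5) for each $i\in V$ and $j\in adj(i)$, $(n_i\wedge n_j)\to\Big(s_i\vee\big[(\bigvee_{k\in adj(i),k\ne j}n_k)\wedge\bigwedge_{l,m\in adj(i),\,l,m\ne j,\,l\ne m}(\neg n_l\vee\neg n_m)\big]\Big)$. $\mathsf{Sol}(F)$ is the set of satisfying assignments. Refinement map $\mathcal{M}'$: for $\tau\in\mathsf{Sol}(F)$, let $V_\tau$ be the set of vertices whose $n$-variable is true in $\tau$; a depth-first search is performed on $V_\tau$ from the starting (terminal) vertex, discarding the components of $V_\tau$ disjoint from it; the resulting simple path is $\mathcal{M}'(\tau)$. $\mathsf{PROB}$: a rooted DAG with $\top$/$\bot$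 leaves, conjunction nodes (children with pairwise disjoint variable sets, representing their conjunction) and decision nodes $n$ labelled by a variable $var(n)$ with children $hi(n)$ (true) and $lo(n)$ (false) whose represented solution sets are disjoint, and branch parameters $\theta_{hi}(n),\theta_{lo}(n)>0$ summing to $1$; smooth means $vars(hi(n))=vars(lo(n))$ for each decision node. $\mathsf{Rep}_\psi(\tau)$ is the set of nodes visited by the top-down traversal that visits all children of conjunction nodes and, at decision node $n$, the child agreeing with $\tau(var(n))$. $\mathsf{ProbSample}$: processes nodes bottom-up with partial samples $\omega$ and weights $\gamma$: $\top$: $\omega=\emptyset,\gamma=1$; $\bot$: $\omega=\mathsf{Invalid},\gamma=0$; conjunction node: union of children's $\omega$, product of children's $\gamma$; decision node $n$: $l=\theta_{lo}(n)\gamma[lo(n)]$, $h=\theta_{hi}(n)\gamma[hi(n)]$, $\gamma[n]=l+h$, and with probability $h/(l+h)$ set $\omega[n]=\omega[hi(n)]\cup\{var(n)\}$, otherwise $\omega[n]=\omega[lo(n)]\cup\{\neg var(n)\}$; output $\omega$ at the root. *)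

theory Defs
  imports "HOL-Probability.Probability"
begin

section \<open>Graphs and trips\<close>

definition ugraph :: "'v set \<Rightarrow> 'v set set \<Rightarrow> bool" where
  "ugraph V E \<longleftrightarrow> finite V \<and> (\<forall>e\<in>E. \<exists>u\<in>V. \<exists>v\<in>V. u \<noteq> v \<and> e = {u, v})"

definition adj :: "'v set set \<Rightarrow> 'v \<Rightarrow> 'v set" where
  "adj E v = {u. {u, v} \<in> E}"

definition path :: "'v set \<Rightarrow> 'v set set \<Rightarrow> 'v list \<Rightarrow> bool" where
  "path V E p \<longleftrightarrow> p \<noteq> [] \<and> set p \<subseteq> V \<and>
     (\<forall>i. Suc i < length p \<longrightarrow> p ! Suc i \<in> adj E (p ! i))"

definition simple_trip :: "'v set \<Rightarrow> 'v set set \<Rightarrow> 'v list \<Rightarrow> bool" where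
  "simple_trip V E p \<longleftrightarrow> path V E p \<and> distinct p \<and>
     (\<forall>v\<in>set p. \<not> (\<exists>a b c. a \<noteq> b \<and> a \<noteq> c \<and> b \<noteq> c \<and> {a, b, c} \<subseteq> adj E v \<inter> set p))"

definition Term :: "'v list \<Rightarrow> 'v set" where
  "Term p = {hd p, last p}"

text \<open>The graph is undirected, so a vertex sequence and its reversal traverse the same trip.\<close>

definition traversals :: "'v list \<Rightarrow> 'v list set" where
  "traversals p = {p, rev p}"


section \<open>The relaxed encoding\<close>

datatype 'v trip_var = N 'v | S 'v

definition trip_vars :: "'v set \<Rightarrow> 'v trip_var set" where
  "trip_vars V = N ` V \<union> S ` V"

definition relaxed_encoding :: "'v set \<Rightarrow> 'v set set \<Rightarrow> ('v trip_var \<Rightarrow> bool) \<Rightarrow> bool" where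
  "relaxed_encoding V E \<tau> \<longleftrightarrow>
     (\<exists>i\<in>V. \<tau> (S i)) \<and>
     (\<forall>i\<in>V. \<tau> (N i) \<longrightarrow> (\<exists>j\<in>adj E i. \<tau> (N j))) \<and>
     (\<forall>i\<in>V. \<forall>j\<in>V. \<forall>k\<in>V. i \<noteq> j \<and> i \<noteq> k \<and> j \<noteq> k \<longrightarrow>
        \<not> \<tau> (S i) \<or> \<not> \<tau> (S j) \<or> \<not> \<tau> (S k)) \<and>
     (\<forall>i\<in>V. \<tau> (S i) \<longrightarrow>
        \<tau> (N i) \<and> (\<forall>j\<in>adj E i. \<forall>k\<in>adj E i. j \<noteq> k \<longrightarrow> \<not> \<tau> (N j) \<or> \<not> \<tau> (N k))) \<and>
     (\<forall>i\<in>V. \<forall>j\<in>adj E i. \<tau> (N i) \<and> \<tau> (N j) \<longrightarrow>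
        \<tau> (S i) \<or>
        ((\<exists>k\<in>adj E i. k \<noteq> j \<and> \<tau> (N k)) \<and>
         (\<forall>l\<in>adj E i. \<forall>m\<in>adj E i. l \<noteq> j \<and> m \<noteq> j \<and> l \<noteq> m \<longrightarrow> \<not> \<tau> (N l) \<or> \<not> \<tau> (N m))))"

text \<open>Assignments to a variable set \<open>X\<close> are extensional functions on \<open>X\<close>, so that solution
  sets over finite \<open>X\<close> are finite.\<close>

definition Sol :: "'x set \<Rightarrow> (('x \<Rightarrow> bool) \<Rightarrow> bool) \<Rightarrow> ('x \<Rightarrow> bool) set" where
  "Sol X F = {\<tau> \<in> X \<rightarrow>\<^sub>E UNIV. F \<tau>}"


section \<open>The refinement map\<close>

text \<open>Depth-first search in the subgraph induced by \<open>U\<close>. A state consists of the stack and of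
  the list of visited vertices in order of discovery. Neighbours may be explored in any order.\<close>

inductive dfs_step :: "'v set set \<Rightarrow> 'v set \<Rightarrow> 'v list \<times> 'v list \<Rightarrow> 'v list \<times> 'v list \<Rightarrow> bool"
  for E U where
  push: "u \<in> adj E v \<inter> U \<Longrightarrow> u \<notin> set vis \<Longrightarrow>
           dfs_step E U (v # st, vis) (u # v # st, vis @ [u])"
| pop: "adj E v \<inter> U \<subseteq> set vis \<Longrightarrow> dfs_step E U (v # st, vis) (st, vis)"

definition dfs :: "'v set set \<Rightarrow> 'v set \<Rightarrow> 'v \<Rightarrow> 'v list \<Rightarrow> bool" where
  "dfs E U s p \<longleftrightarrow> (dfs_step E U)\<^sup>*\<^sup>* ([s], [s]) ([], p)"

text \<open>The trip encoded by \<open>\<tau>\<close>, given by its traversals: either of its terminal vertices may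
  serve as the start of the search. For a solution \<open>\<tau>\<close> of the relaxed encoding, the component of
  the terminal vertices is a simple path, so the search is deterministic once its start is fixed,
  and the two starts yield a vertex sequence and its reversal.\<close>

definition refine :: "'v set \<Rightarrow> 'v set set \<Rightarrow> ('v trip_var \<Rightarrow> bool) \<Rightarrow> 'v list set" where
  "refine V E \<tau> = {p. \<exists>s\<in>V. \<tau> (S s) \<and> dfs E {i\<in>V. \<tau> (N i)} s p}"

definition R :: "'v set \<Rightarrow> 'v set set \<Rightarrow> 'v list \<Rightarrow> ('v trip_var \<Rightarrow> bool) set" where
  "R V E \<pi> = {\<tau> \<in> Sol (trip_vars V) (relaxed_encoding V E). refine V E \<tau> = traversals \<pi>}"


section \<open>PROB\<close>

datatype ('n, 'x) prob_node =
    TrueLeaf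
  | FalseLeaf
  | Conjunction "'n set"
  | is_Decision: Decision (var: 'x) (hi: 'n) (lo: 'n) (theta_hi: real) (theta_lo: real)

record ('n, 'x) prob_dag =
  pnodes :: "'n set"
  proot :: 'n
  plabel :: "'n \<Rightarrow> ('n, 'x) prob_node"

fun children :: "('n, 'x) prob_node \<Rightarrow> 'n set" where
  "children TrueLeaf = {}"
| "children FalseLeaf = {}"
| "children (Conjunction C) = C"
| "children (Decision x h l a b) = {h, l}"

definition edges :: "('n, 'x) prob_dag \<Rightarrow> ('n \<times> 'n) set" where
  "edges \<psi> = {(n, c). n \<in> pnodes \<psi> \<and> c \<in> children (plabel \<psi> n)}"

definition vars :: "('n, 'x) prob_dag \<Rightarrow> 'n \<Rightarrow> 'x set" where
  "vars \<psi> n = {var (plabel \<psi> m) | m. (n, m) \<in> (edges \<psi>)\<^sup>* \<and> is_Decision (plabel \<psi> m)}"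

text \<open>The Boolean function represented by a node.\<close>

inductive sat :: "('n, 'x) prob_dag \<Rightarrow> ('x \<Rightarrow> bool) \<Rightarrow> 'n \<Rightarrow> bool" for \<psi> \<tau> where
  "plabel \<psi> n = TrueLeaf \<Longrightarrow> sat \<psi> \<tau> n"
| "plabel \<psi> n = Conjunction C \<Longrightarrow> \<forall>c\<in>C. sat \<psi> \<tau> c \<Longrightarrow> sat \<psi> \<tau> n"
| "plabel \<psi> n = Decision x h l a b \<Longrightarrow> sat \<psi> \<tau> (if \<tau> x then h else l) \<Longrightarrow> sat \<psi> \<tau> n"

text \<open>Disjointness at a decision node concerns the solution sets of the two children themselves;
  with the branch literals \<open>x\<close> and \<open>\<not> x\<close> added it would hold trivially. It is what makes the
  indicator ``the true child lies in \<open>Rep \<psi> \<tau>\<close>'' agree with the branch taken by \<open>\<tau>\<close>, also when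
  nodes are shared. It does not limit which graphs have a PROB: two solutions of the relaxed encoding
  never differ in exactly one variable.\<close>

definition is_PROB :: "('n, 'x) prob_dag \<Rightarrow> bool" where
  "is_PROB \<psi> \<longleftrightarrow>
     finite (pnodes \<psi>) \<and> proot \<psi> \<in> pnodes \<psi> \<and>
     (\<forall>n\<in>pnodes \<psi>. children (plabel \<psi> n) \<subseteq> pnodes \<psi>) \<and>
     (\<forall>n\<in>pnodes \<psi>. (proot \<psi>, n) \<in> (edges \<psi>)\<^sup>*) \<and>
     acyclic (edges \<psi>) \<and>
     (\<forall>n\<in>pnodes \<psi>. \<forall>C. plabel \<psi> n = Conjunction C \<longrightarrow>
        (\<forall>c\<in>C. \<forall>d\<in>C. c \<noteq> d \<longrightarrow> vars \<psi> c \<inter> vars \<psi> d = {})) \<and>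
     (\<forall>n\<in>pnodes \<psi>. \<forall>x h l a b. plabel \<psi> n = Decision x h l a b \<longrightarrow>
        {\<tau>. sat \<psi> \<tau> h} \<inter> {\<tau>. sat \<psi> \<tau> l} = {} \<and> a > 0 \<and> b > 0 \<and> a + b = 1)"

definition smooth :: "('n, 'x) prob_dag \<Rightarrow> bool" where
  "smooth \<psi> \<longleftrightarrow> (\<forall>n\<in>pnodes \<psi>. is_Decision (plabel \<psi> n) \<longrightarrow>
     vars \<psi> (hi (plabel \<psi> n)) = vars \<psi> (lo (plabel \<psi> n)))"

text \<open>\<open>\<psi>\<close> represents the formula \<open>F\<close> over the variables \<open>X\<close>. Only an inclusion of variable sets is
  required, so that a bare false leaf represents an unsatisfiable formula.\<close>

definition represents :: "('n, 'x) prob_dag \<Rightarrow> 'x set \<Rightarrow> (('x \<Rightarrow> bool) \<Rightarrow> bool) \<Rightarrow> bool" where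
  "represents \<psi> X F \<longleftrightarrow>
     vars \<psi> (proot \<psi>) \<subseteq> X \<and> Sol X (\<lambda>\<tau>. sat \<psi> \<tau> (proot \<psi>)) = Sol X F"

inductive_set Rep :: "('n, 'x) prob_dag \<Rightarrow> ('x \<Rightarrow> bool) \<Rightarrow> 'n set" for \<psi> \<tau> where
  "proot \<psi> \<in> Rep \<psi> \<tau>"
| "n \<in> Rep \<psi> \<tau> \<Longrightarrow> plabel \<psi> n = Conjunction C \<Longrightarrow> c \<in> C \<Longrightarrow> c \<in> Rep \<psi> \<tau>"
| "n \<in> Rep \<psi> \<tau> \<Longrightarrow> plabel \<psi> n = Decision x h l a b \<Longrightarrow> (if \<tau> x then h else l) \<in> Rep \<psi> \<tau>"


section \<open>ProbSample\<close>

text \<open>A partial sample is a set of literals \<open>(x, b)\<close>, or \<open>None\<close> if it is invalid. The state maps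
  every processed node to its partial sample and its weight.\<close>

type_synonym 'x partial_sample = "('x \<times> bool) set option"
type_synonym ('n, 'x) sampler_state = "'n \<Rightarrow> 'x partial_sample \<times> real"

definition union_samples :: "'x partial_sample set \<Rightarrow> 'x partial_sample" where
  "union_samples W = (if None \<in> W then None else Some (\<Union>(the ` W)))"

fun process_node ::
    "('n, 'x) prob_node \<Rightarrow> ('n, 'x) sampler_state \<Rightarrow> ('x partial_sample \<times> real) pmf" where
  "process_node TrueLeaf st = return_pmf (Some {}, 1)"
| "process_node FalseLeaf st = return_pmf (None, 0)"
| "process_node (Conjunction C) st =
     return_pmf (union_samples ((\<lambda>c. fst (st c)) ` C), \<Prod>c\<in>C. snd (st c))"
| "process_node (Decision x h l \<theta>h \<theta>l) st =
     (let wl = \<theta>l * snd (st l); wh = \<theta>h * snd (st h) in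
      map_pmf (\<lambda>b. (if b then map_option (insert (x, True)) (fst (st h))
                    else map_option (insert (x, False)) (fst (st l)), wl + wh))
        (bernoulli_pmf (wh / (wl + wh))))"

fun process_nodes ::
    "('n, 'x) prob_dag \<Rightarrow> 'n list \<Rightarrow> ('n, 'x) sampler_state \<Rightarrow> ('n, 'x) sampler_state pmf" where
  "process_nodes \<psi> [] st = return_pmf st"
| "process_nodes \<psi> (n # ns) st =
     bind_pmf (process_node (plabel \<psi> n) st) (\<lambda>r. process_nodes \<psi> ns (st(n := r)))"

definition bottom_up :: "('n, 'x) prob_dag \<Rightarrow> 'n list \<Rightarrow> bool" where
  "bottom_up \<psi> ns \<longleftrightarrow> distinct ns \<and> set ns = pnodes \<psi> \<and>
     (\<forall>i<length ns. children (plabel \<psi> (ns ! i)) \<subseteq> set (take i ns))"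

text \<open>The initial state is irrelevant: every entry is written before it is read.\<close>

definition ProbSample :: "('n, 'x) prob_dag \<Rightarrow> 'n list \<Rightarrow> 'x partial_sample pmf" where
  "ProbSample \<psi> ns = map_pmf (\<lambda>st. fst (st (proot \<psi>))) (process_nodes \<psi> ns (\<lambda>_. (None, 0)))"

text \<open>A set of literals denotes an assignment to \<open>X\<close> if it contains exactly one literal of every
  variable in \<open>X\<close> and no other literals.\<close>

definition assignment_of :: "'x set \<Rightarrow> ('x \<times> bool) set \<Rightarrow> ('x \<Rightarrow> bool) option" where
  "assignment_of X L =
     (let \<tau> = (\<lambda>x\<in>X. (x, True) \<in> L) in if L = (\<lambda>x. (x, \<tau> x)) ` X then Some \<tau> else None)"

definition sample_trip ::
    "'v set \<Rightarrow> 'v set set \<Rightarrow> ('n, 'v trip_var) prob_dag \<Rightarrow> 'n list \<Rightarrow> 'v list set option pmf" where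
  "sample_trip V E \<psi> ns =
     map_pmf (\<lambda>\<omega>. map_option (refine V E) (Option.bind \<omega> (assignment_of (trip_vars V))))
       (ProbSample \<psi> ns)"

end

theory Submission
  imports Defs
begin

text \<open>
  The weights computed by ProbSample are deterministic, so the branches chosen at the decision
  nodes are independent and branch \<open>b\<close> of node \<open>n\<close> is taken with probability
  \<open>\<theta>\<^sub>b(n) \<gamma>[b(n)] / \<gamma>[n]\<close>. An assignment \<open>\<tau>\<close> is sampled iff every decision node of \<open>Rep \<psi> \<tau>\<close> takes
  the branch prescribed by \<open>\<tau>\<close>. The decision nodes of \<open>Rep \<psi> \<tau>\<close> form a tree because children of a
  conjunction share no variable, hence the product of these probabilities telescopes to the
  product of the parameters divided by \<open>\<gamma>[root]\<close>, and the proportionality constant is \<open>1 / \<gamma>[root]\<close>.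
  Smoothness makes the sampled literals cover all variables below the root. These are all
  variables of the encoding, since a missing variable could be flipped in a solution, whereas two
  solutions of the relaxed encoding never differ in exactly one variable.
\<close>

section \<open>Solutions of the relaxed encoding\<close>

lemma adj_subset:
  assumes "ugraph V E"
  shows "adj E i \<subseteq> V"
  using assms by (fastforce simp: ugraph_def adj_def doubleton_eq_iff)

lemma not_in_adj_self:
  assumes "ugraph V E"
  shows "i \<notin> adj E i"
  using assms by (fastforce simp: ugraph_def adj_def doubleton_eq_iff)

lemma adj_sym: "j \<in> adj E i \<longleftrightarrow> i \<in> adj E j"
  by (simp add: adj_def insert_commute)

lemma relaxed_encodingD:
  assumes "relaxed_encoding V E \<tau>" "i \<in> V"
  shows "\<tau> (N i) \<Longrightarrow> \<exists>j\<in>adj E i. \<tau> (N j)"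
    and "\<tau> (S i) \<Longrightarrow> \<tau> (N i)"
    and "\<tau> (S i) \<Longrightarrow> j \<in> adj E i \<Longrightarrow> k \<in> adj E i \<Longrightarrow> \<tau> (N j) \<Longrightarrow> \<tau> (N k) \<Longrightarrow> j = k"
    and "j \<in> adj E i \<Longrightarrow> \<tau> (N i) \<Longrightarrow> \<tau> (N j) \<Longrightarrow> \<not> \<tau> (S i) \<Longrightarrow> \<exists>k\<in>adj E i. k \<noteq> j \<and> \<tau> (N k)"
    and "j \<in> adj E i \<Longrightarrow> \<tau> (N i) \<Longrightarrow> \<tau> (N j) \<Longrightarrow> \<not> \<tau> (S i) \<Longrightarrow> l \<in> adj E i \<Longrightarrow> m \<in> adj E i \<Longrightarrow>
      l \<noteq> j \<Longrightarrow> m \<noteq> j \<Longrightarrow> \<tau> (N l) \<Longrightarrow> \<tau> (N m) \<Longrightarrow> l = m"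
proof -
  note F = assms(1)[unfolded relaxed_encoding_def, THEN conjunct2]
  note H2 = F[THEN conjunct1, THEN bspec, OF assms(2)]
  note H4 = F[THEN conjunct2, THEN conjunct2, THEN conjunct1, THEN bspec, OF assms(2)]
  note H5 = F[THEN conjunct2, THEN conjunct2, THEN conjunct2, THEN bspec, OF assms(2)]
  show "\<tau> (N i) \<Longrightarrow> \<exists>j\<in>adj E i. \<tau> (N j)"
    using H2 by blast
  show "\<tau> (S i) \<Longrightarrow> \<tau> (N i)"
    using H4 by blast
  show "\<tau> (S i) \<Longrightarrow> j \<in> adj E i \<Longrightarrow> k \<in> adj E i \<Longrightarrow> \<tau> (N j) \<Longrightarrow> \<tau> (N k) \<Longrightarrow> j = k"
    using H4 by blast
  show "j \<in> adj E i \<Longrightarrow> \<tau> (N i) \<Longrightarrow> \<tau> (N j) \<Longrightarrow> \<not> \<tau> (S i) \<Longrightarrow> \<exists>k\<in>adj E i. k \<noteq> j \<and> \<tau> (N k)"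
    using H5 by blast
  show "j \<in> adj E i \<Longrightarrow> \<tau> (N i) \<Longrightarrow> \<tau> (N j) \<Longrightarrow> \<not> \<tau> (S i) \<Longrightarrow> l \<in> adj E i \<Longrightarrow> m \<in> adj E i \<Longrightarrow>
      l \<noteq> j \<Longrightarrow> m \<noteq> j \<Longrightarrow> \<tau> (N l) \<Longrightarrow> \<tau> (N m) \<Longrightarrow> l = m"
    using H5 by blast
qed

text \<open>If \<open>N i\<close> is cleared, a neighbour \<open>j\<close> of \<open>i\<close> on
  the trip must have another neighbour \<open>k\<close>, so it was not terminal; as an inner vertex
  it then needs one more neighbour besides \<open>k\<close>, and together with \<open>i\<close> it
  had three. If \<open>S i\<close> is cleared, \<open>i\<close> becomes an inner vertex and needs
  two neighbours, but as a terminal it had only one.\<close>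

lemma relaxed_encoding_fun_upd_False:
  assumes G: "ugraph V E" and F: "relaxed_encoding V E \<tau>" and x: "x \<in> trip_vars V" "\<tau> x"
  shows "\<not> relaxed_encoding V E (\<tau>(x := False))"
proof
  assume F': "relaxed_encoding V E (\<tau>(x := False))"
  note D = relaxed_encodingD[OF F] and D' = relaxed_encodingD[OF F']
  from x(1) consider i where "i \<in> V" "x = N i" | i where "i \<in> V" "x = S i"
    by (auto simp: trip_vars_def)
  then show False
  proof cases
    case 1
    have N': "(\<tau>(x := False)) (N k) \<longleftrightarrow> k \<noteq> i \<and> \<tau> (N k)"
      and S': "(\<tau>(x := False)) (S k) \<longleftrightarrow> \<tau> (S k)" for k
      using 1 by auto
    have N: "\<tau> (N i)"
      using x(2) 1 by simp
    obtain j where j: "j \<in> adj E i" "\<tau> (N j)"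
      using D(1)[OF 1(1) N] by blast
    have jV: "j \<in> V" and ij: "i \<in> adj E j" "j \<noteq> i"
      using j(1) adj_subset[OF G] adj_sym[of j E i] not_in_adj_self[OF G] by auto
    obtain k where k: "k \<in> adj E j" "\<tau> (N k)" "k \<noteq> i"
      using D'(1)[OF jV] j(2) ij(2) unfolding N' by blast
    have nS: "\<not> \<tau> (S j)"
      using D(3)[OF jV _ ij(1) k(1) N k(2)] k(3) by blast
    obtain k' where k': "k' \<in> adj E j" "\<tau> (N k')" "k' \<noteq> i" "k' \<noteq> k"
      using D'(4)[OF jV k(1)] nS j(2) k(2,3) ij(2) unfolding N' S' by blast
    show False
      using D(5)[OF jV ij(1) j(2) N nS k(1) k'(1) k(3) k'(3) k(2) k'(2)] k'(4) by blast
  next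
    case 2
    have N': "(\<tau>(x := False)) (N k) \<longleftrightarrow> \<tau> (N k)"
      and S': "\<not> (\<tau>(x := False)) (S i)" for k
      using 2 by auto
    have S: "\<tau> (S i)"
      using x(2) 2 by simp
    note N = D(2)[OF 2(1) S]
    obtain j where j: "j \<in> adj E i" "\<tau> (N j)"
      using D(1)[OF 2(1) N] by blast
    obtain k where "k \<in> adj E i" "k \<noteq> j" "\<tau> (N k)"
      using D'(4)[OF 2(1) j(1) _ _ S'] N j(2) unfolding N' by blast
    then show False
      using D(3)[OF 2(1) S _ j(1), of k] j(2) by blast
  qed
qed

lemma relaxed_encoding_flip:
  assumes G: "ugraph V E" and F: "relaxed_encoding V E \<tau>" and x: "x \<in> trip_vars V"
  shows "\<not> relaxed_encoding V E (\<tau>(x := \<not> \<tau> x))"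
proof (cases "\<tau> x")
  case True
  then show ?thesis
    using relaxed_encoding_fun_upd_False[OF G F x] by simp
next
  case False
  \<comment> \<open>Setting a false variable is undone by clearing it, so the previous lemma applied
    to the updated assignment covers this direction.\<close>
  have "\<tau>(x := True, x := False) = \<tau>"
    using False by (simp add: fun_eq_iff)
  then have "\<not> relaxed_encoding V E (\<tau>(x := True))"
    using relaxed_encoding_fun_upd_False[OF G _ x, of "\<tau>(x := True)"] F by (metis fun_upd_same)
  then show ?thesis
    using False by simp
qed

section \<open>The branches taken by an assignment\<close>

text \<open>Conjunction and decision nodes both become nodes with a set of children that \<tau>
  follows, so most facts about \<open>sat\<close> and \<open>Rep\<close> need no separate
  cases.\<close>

fun branches :: "('x \<Rightarrow> bool) \<Rightarrow> ('n, 'x) prob_node \<Rightarrow> 'n set" where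
  "branches \<tau> TrueLeaf = {}"
| "branches \<tau> FalseLeaf = {}"
| "branches \<tau> (Conjunction C) = C"
| "branches \<tau> (Decision x h l a b) = {if \<tau> x then h else l}"

text \<open>\<open>Rep\<close> is anchored at the root; a traversal from an arbitrary node permits
  induction along the DAG.\<close>

definition Rep_from :: "('n, 'x) prob_dag \<Rightarrow> ('x \<Rightarrow> bool) \<Rightarrow> 'n \<Rightarrow> 'n set" where
  "Rep_from \<psi> \<tau> n = {(n, c). c \<in> branches \<tau> (plabel \<psi> n)}\<^sup>* `` {n}"

definition Rep_decisions :: "('n, 'x) prob_dag \<Rightarrow> ('x \<Rightarrow> bool) \<Rightarrow> 'n \<Rightarrow> 'n set" where
  "Rep_decisions \<psi> \<tau> n = {m \<in> Rep_from \<psi> \<tau> n. is_Decision (plabel \<psi> m)}"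

fun branch_param :: "('x \<Rightarrow> bool) \<Rightarrow> ('n, 'x) prob_node \<Rightarrow> real" where
  "branch_param \<tau> (Decision x h l a b) = (if \<tau> x then a else b)"
| "branch_param \<tau> _ = 1"

text \<open>For positive weight, the probability that ProbSample follows \<tau> at a node, with
  \<open>W\<close> in the role of \<gamma>. The value 1 at other nodes allows products over all of
  \<open>Rep\<close>.\<close>

fun branch_prob :: "('n \<Rightarrow> real) \<Rightarrow> ('x \<Rightarrow> bool) \<Rightarrow> ('n, 'x) prob_node \<Rightarrow> real" where
  "branch_prob W \<tau> (Decision x h l a b) =
     (if \<tau> x then a * W h else b * W l) / (b * W l + a * W h)"
| "branch_prob W \<tau> _ = 1"

lemma branches_children: "c \<in> branches \<tau> L \<Longrightarrow> c \<in> children L"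
  by (cases L) (simp_all split: if_splits)

lemma Rep_from_unfold:
  "Rep_from \<psi> \<tau> n = insert n (\<Union>c\<in>branches \<tau> (plabel \<psi> n). Rep_from \<psi> \<tau> c)"
  unfolding Rep_from_def by (auto elim: converse_rtranclE intro: converse_rtrancl_into_rtrancl)

lemma Rep_decisions_unfold:
  "Rep_decisions \<psi> \<tau> n = (if is_Decision (plabel \<psi> n) then {n} else {}) \<union>
     (\<Union>c\<in>branches \<tau> (plabel \<psi> n). Rep_decisions \<psi> \<tau> c)"
  unfolding Rep_decisions_def by (subst Rep_from_unfold) auto

lemma Rep_branches:
  assumes "n \<in> Rep \<psi> \<tau>" "c \<in> branches \<tau> (plabel \<psi> n)"
  shows "c \<in> Rep \<psi> \<tau>"
proof (cases "plabel \<psi> n")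
  case (Conjunction C)
  then show ?thesis
    using Rep.intros(2)[OF assms(1) Conjunction] assms(2) by simp
next
  case (Decision x h l a b)
  then show ?thesis
    using Rep.intros(3)[OF assms(1) Decision] assms(2) by simp
qed (use assms in simp_all)

lemma proot_in_Rep_from: "proot \<psi> \<in> Rep_from \<psi> \<tau> (proot \<psi>)"
  by (simp add: Rep_from_def)

lemma Rep_from_branches:
  assumes "m \<in> Rep_from \<psi> \<tau> n" "c \<in> branches \<tau> (plabel \<psi> m)"
  shows "c \<in> Rep_from \<psi> \<tau> n"
  using assms rtrancl_into_rtrancl[of n m "{(n, c). c \<in> branches \<tau> (plabel \<psi> n)}" c]
  by (simp add: Rep_from_def)

lemma Rep_eq_Rep_from: "Rep \<psi> \<tau> = Rep_from \<psi> \<tau> (proot \<psi>)"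
proof (intro set_eqI iffI)
  fix n assume "n \<in> Rep \<psi> \<tau>"
  then show "n \<in> Rep_from \<psi> \<tau> (proot \<psi>)"
  proof induction
    case 1
    show ?case by (rule proot_in_Rep_from)
  next
    case (2 n C c)
    then show ?case using Rep_from_branches[of n \<psi> \<tau> _ c] by simp
  next
    case (3 n x h l a b)
    then show ?case using Rep_from_branches[of n \<psi> \<tau> _ "if \<tau> x then h else l"] by simp
  qed
next
  fix n assume "n \<in> Rep_from \<psi> \<tau> (proot \<psi>)"
  then have "(proot \<psi>, n) \<in> {(n, c). c \<in> branches \<tau> (plabel \<psi> n)}\<^sup>*"
    by (simp add: Rep_from_def)
  then show "n \<in> Rep \<psi> \<tau>"
  proof induction
    case base
    show ?case by (rule Rep.intros(1))
  next
    case (step m c)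
    then show ?case using Rep_branches[of m \<psi> \<tau> c] by simp
  qed
qed

lemma sat_branches:
  assumes "sat \<psi> \<tau> n" "c \<in> branches \<tau> (plabel \<psi> n)"
  shows "sat \<psi> \<tau> c"
  using assms by (cases rule: sat.cases) auto

lemma not_sat_FalseLeaf:
  assumes "plabel \<psi> n = FalseLeaf"
  shows "\<not> sat \<psi> \<tau> n"
  using assms by (auto elim: sat.cases)

text \<open>Leaves have no branches, so the second premise is vacuous at a true leaf, and only a
  false leaf has to be excluded.\<close>

lemma satI:
  assumes "plabel \<psi> n \<noteq> FalseLeaf" "\<And>c. c \<in> branches \<tau> (plabel \<psi> n) \<Longrightarrow> sat \<psi> \<tau> c"
  shows "sat \<psi> \<tau> n"
  using assms by (cases "plabel \<psi> n") (auto intro: sat.intros)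

lemma sat_Rep:
  assumes "sat \<psi> \<tau> (proot \<psi>)" "n \<in> Rep \<psi> \<tau>"
  shows "sat \<psi> \<tau> n"
  using assms(2,1) by induction (auto dest: sat_branches)

lemma vars_unfold:
  assumes "n \<in> pnodes \<psi>"
  shows "vars \<psi> n = (if is_Decision (plabel \<psi> n) then {var (plabel \<psi> n)} else {}) \<union>
     (\<Union>c\<in>children (plabel \<psi> n). vars \<psi> c)"
proof -
  have *: "(n, m) \<in> (edges \<psi>)\<^sup>* \<longleftrightarrow> m = n \<or> (\<exists>c\<in>children (plabel \<psi> n). (c, m) \<in> (edges \<psi>)\<^sup>*)" for m
    using assms
    by (auto simp: edges_def elim: converse_rtranclE intro: converse_rtrancl_into_rtrancl)
  show ?thesis
    unfolding vars_def * by auto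
qed

section \<open>Induction, reachability and disjointness in a PROB\<close>

locale PROB =
  fixes \<psi> :: "('n, 'x) prob_dag"
  assumes is_PROB: "is_PROB \<psi>"
begin

lemma finite_pnodes: "finite (pnodes \<psi>)"
  and proot_in_pnodes: "proot \<psi> \<in> pnodes \<psi>"
  and acyclic_edges: "acyclic (edges \<psi>)"
  using is_PROB by (simp_all add: is_PROB_def)

lemma children_in_pnodes: "n \<in> pnodes \<psi> \<Longrightarrow> c \<in> children (plabel \<psi> n) \<Longrightarrow> c \<in> pnodes \<psi>"
  using is_PROB[unfolded is_PROB_def, THEN conjunct2, THEN conjunct2, THEN conjunct1] by blast

lemma Conjunction_vars_disjoint:
  assumes "n \<in> pnodes \<psi>" "plabel \<psi> n = Conjunction C" "c \<in> C" "d \<in> C" "c \<noteq> d"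
  shows "vars \<psi> c \<inter> vars \<psi> d = {}"
  using assms is_PROB by (simp add: is_PROB_def)

lemma
  assumes "n \<in> pnodes \<psi>" "plabel \<psi> n = Decision x h l a b"
  shows Decision_params: "a > 0 \<and> b > 0"
    and Decision_sat_disjoint: "{\<tau>. sat \<psi> \<tau> h} \<inter> {\<tau>. sat \<psi> \<tau> l} = {}"
  using assms is_PROB by (simp_all add: is_PROB_def)

lemma branches_in_pnodes: "n \<in> pnodes \<psi> \<Longrightarrow> c \<in> branches \<tau> (plabel \<psi> n) \<Longrightarrow> c \<in> pnodes \<psi>"
  using children_in_pnodes branches_children by metis

lemma finite_children: "n \<in> pnodes \<psi> \<Longrightarrow> finite (children (plabel \<psi> n))"
  by (rule finite_subset[OF subsetI finite_pnodes]) (rule children_in_pnodes)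

text \<open>Bottom-up induction: the edge relation is finite and acyclic, hence its converse is
  well-founded.\<close>

lemma node_induct [consumes 1, case_names node]:
  assumes "n \<in> pnodes \<psi>"
    and step: "\<And>n. n \<in> pnodes \<psi> \<Longrightarrow> (\<And>c. c \<in> children (plabel \<psi> n) \<Longrightarrow> Q c) \<Longrightarrow> Q n"
  shows "Q n"
proof -
  have "edges \<psi> \<subseteq> pnodes \<psi> \<times> pnodes \<psi>"
    unfolding edges_def by (clarsimp, rule children_in_pnodes)
  then have "wf ((edges \<psi>)\<inverse>)"
    using finite_acyclic_wf_converse acyclic_edges finite_pnodes
    by (meson finite_SigmaI finite_subset)
  then show ?thesis
    using assms(1)
  proof (induction n rule: wf_induct_rule)
    case (less n)
    show ?case
    proof (rule step[OF less.prems])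
      fix c assume c: "c \<in> children (plabel \<psi> n)"
      show "Q c"
        by (rule less.IH) (use c less.prems children_in_pnodes[OF less.prems c] in \<open>simp_all add: edges_def\<close>)
    qed
  qed
qed

lemma Rep_from_edges:
  assumes "n \<in> pnodes \<psi>" "m \<in> Rep_from \<psi> \<tau> n"
  shows "(n, m) \<in> (edges \<psi>)\<^sup>* \<and> m \<in> pnodes \<psi>"
proof -
  have "(n, m) \<in> {(n, c). c \<in> branches \<tau> (plabel \<psi> n)}\<^sup>*"
    using assms(2) by (simp add: Rep_from_def)
  then show ?thesis
  proof induction
    case base
    show ?case using assms(1) by simp
  next
    case (step m c)
    then have c: "c \<in> children (plabel \<psi> m)" and m: "m \<in> pnodes \<psi>" "(n, m) \<in> (edges \<psi>)\<^sup>*"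
      by (simp_all add: branches_children)
    then have "(m, c) \<in> edges \<psi>"
      by (simp add: edges_def)
    with m show ?case
      using children_in_pnodes[OF m(1) c] by (simp add: rtrancl_into_rtrancl)
  qed
qed

lemma Rep_subset_pnodes: "Rep \<psi> \<tau> \<subseteq> pnodes \<psi>"
  using Rep_from_edges[OF proot_in_pnodes] by (auto simp: Rep_eq_Rep_from)

lemma finite_Rep_decisions: "n \<in> pnodes \<psi> \<Longrightarrow> finite (Rep_decisions \<psi> \<tau> n)"
  by (rule finite_subset[OF _ finite_pnodes]) (use Rep_from_edges in \<open>auto simp: Rep_decisions_def\<close>)

text \<open>This carries the disjointness of variable sets below a conjunction over to the decision
  nodes visited there.\<close>

lemma Rep_decisions_vars:
  "n \<in> pnodes \<psi> \<Longrightarrow> m \<in> Rep_decisions \<psi> \<tau> n \<Longrightarrow> var (plabel \<psi> m) \<in> vars \<psi> n"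
  using Rep_from_edges[of n m \<tau>] by (auto simp: Rep_decisions_def vars_def)

text \<open>The edge from \<open>n\<close> to \<open>c\<close> and a path from \<open>c\<close> back
  to \<open>n\<close> would form a cycle. Thus the factor of \<open>n\<close> can be split off
  products over \<open>Rep_decisions\<close>.\<close>

lemma not_in_Rep_decisions_branch:
  assumes "n \<in> pnodes \<psi>" "c \<in> branches \<tau> (plabel \<psi> n)"
  shows "n \<notin> Rep_decisions \<psi> \<tau> c"
proof
  assume "n \<in> Rep_decisions \<psi> \<tau> c"
  then have "(c, n) \<in> (edges \<psi>)\<^sup>*"
    using Rep_from_edges[of c n \<tau>] branches_in_pnodes[OF assms] by (auto simp: Rep_decisions_def)
  moreover have "(n, c) \<in> edges \<psi>"
    using assms by (simp add: edges_def branches_children)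
  ultimately have "(n, n) \<in> (edges \<psi>)\<^sup>+"
    by (rule rtrancl_into_trancl2[rotated])
  then show False
    using acyclic_edges by (simp add: acyclic_def)
qed

lemma sat_cong:
  assumes "n \<in> pnodes \<psi>" "\<And>x. x \<in> vars \<psi> n \<Longrightarrow> \<tau> x = \<tau>' x"
  shows "sat \<psi> \<tau> n \<Longrightarrow> sat \<psi> \<tau>' n"
  using assms
proof (induction rule: node_induct)
  case (node n)
  \<comment> \<open>A variable tested at \<open>n\<close> belongs to \<open>vars \<psi> n\<close>,
    so both assignments follow the same branches.\<close>
  have *: "branches \<tau> (plabel \<psi> n) = branches \<tau>' (plabel \<psi> n)"
    using node.prems(2) vars_unfold[OF node.hyps] by (cases "plabel \<psi> n") auto
  show ?case
  proof (rule satI)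
    show "plabel \<psi> n \<noteq> FalseLeaf"
      using node.prems(1) not_sat_FalseLeaf by metis
  next
    fix c assume c: "c \<in> branches \<tau>' (plabel \<psi> n)"
    then have c': "c \<in> children (plabel \<psi> n)"
      by (rule branches_children)
    show "sat \<psi> \<tau>' c"
    proof (rule node.IH[OF c'])
      show "sat \<psi> \<tau> c"
        using sat_branches[OF node.prems(1)] c * by simp
      show "\<tau> x = \<tau>' x" if "x \<in> vars \<psi> c" for x
        using node.prems(2) that c' vars_unfold[OF node.hyps] by blast
    qed
  qed
qed

text \<open>Nodes may be shared, so \<open>h\<close> might be visited by another route although
  \<tau> makes \<open>x\<close> false. But visited nodes are satisfied, and the two children have
  disjoint solution sets, so a visited \<open>h\<close> keeps \<open>l\<close> from being
  visited.\<close>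

lemma hi_in_Rep_iff:
  assumes sat: "sat \<psi> \<tau> (proot \<psi>)" and n: "n \<in> Rep \<psi> \<tau>"
    and lab: "plabel \<psi> n = Decision x h l a b"
  shows "h \<in> Rep \<psi> \<tau> \<longleftrightarrow> \<tau> x"
proof
  assume "\<tau> x"
  then show "h \<in> Rep \<psi> \<tau>"
    using Rep_branches[OF n] lab by simp
next
  assume h: "h \<in> Rep \<psi> \<tau>"
  have "n \<in> pnodes \<psi>"
    using n Rep_subset_pnodes by auto
  then have "\<not> sat \<psi> \<tau> l"
    using sat_Rep[OF sat h] Decision_sat_disjoint[OF _ lab] by blast
  then have "l \<notin> Rep \<psi> \<tau>"
    using sat_Rep[OF sat] by blast
  then have "l \<notin> branches \<tau> (plabel \<psi> n)"
    using Rep_branches[OF n] by blast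
  then show "\<tau> x"
    using lab by (simp split: if_splits)
qed

end

section \<open>Weights\<close>

fun node_weight :: "('n, 'x) prob_node \<Rightarrow> ('n \<Rightarrow> real) \<Rightarrow> real" where
  "node_weight TrueLeaf W = 1"
| "node_weight FalseLeaf W = 0"
| "node_weight (Conjunction C) W = (\<Prod>c\<in>C. W c)"
| "node_weight (Decision x h l a b) W = b * W l + a * W h"

text \<open>The coin flips affect only the partial sample, so the weight of a node is a function of
  its children's weights alone.\<close>

lemma snd_process_node:
  "r \<in> set_pmf (process_node L st) \<Longrightarrow> snd r = node_weight L (\<lambda>n. snd (st n))"
  by (cases L) (auto simp: Let_def)

lemma node_weight_cong:
  "(\<And>c. c \<in> children L \<Longrightarrow> W c = W' c) \<Longrightarrow> node_weight L W = node_weight L W'"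
  by (cases L) (auto intro: prod.cong)

lemma process_node_cong:
  assumes "\<And>c. c \<in> children L \<Longrightarrow> st c = st' c"
  shows "process_node L st = process_node L st'"
proof (cases L)
  case (Conjunction C)
  then have "(\<lambda>c. fst (st c)) ` C = (\<lambda>c. fst (st' c)) ` C" "(\<Prod>c\<in>C. snd (st c)) = (\<Prod>c\<in>C. snd (st' c))"
    using assms by (auto intro!: image_cong prod.cong)
  with Conjunction show ?thesis by simp
next
  case (Decision x h l a b)
  then have "st h = st' h" "st l = st' l"
    using assms by simp_all
  then show ?thesis
    by (simp only: Decision process_node.simps)
qed simp_all

text \<open>\<open>W\<close> is any solution of the recursion by which ProbSample computes its
  weights; this separates the deterministic weights from the random samples.\<close>

locale weighted_PROB = PROB \<psi> for \<psi> :: "('n, 'x) prob_dag" +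
  fixes W :: "'n \<Rightarrow> real"
  assumes weight: "n \<in> pnodes \<psi> \<Longrightarrow> W n = node_weight (plabel \<psi> n) W"
begin

lemma weight_nonneg: "n \<in> pnodes \<psi> \<Longrightarrow> W n \<ge> 0"
proof (induction rule: node_induct)
  case (node n)
  show ?case
  proof (cases "plabel \<psi> n")
    case (Conjunction C)
    then show ?thesis
      using node.IH by (simp add: weight[OF node.hyps] prod_nonneg)
  next
    case (Decision x h l a b)
    then show ?thesis
      using node.IH Decision_params[OF node.hyps Decision] by (simp add: weight[OF node.hyps])
  qed (simp_all add: weight[OF node.hyps])
qed

text \<open>The children followed by \<tau> are satisfied and hence have positive weight, and the
  other child of a decision node contributes a nonnegative term. This keeps the denominators of
  \<open>branch_prob\<close> away from zero.\<close>

lemma weight_pos: "n \<in> pnodes \<psi> \<Longrightarrow> sat \<psi> \<tau> n \<Longrightarrow> W n > 0"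
proof (induction rule: node_induct)
  case (node n)
  have pos: "W c > 0" if "c \<in> branches \<tau> (plabel \<psi> n)" for c
    using that by (intro node.IH branches_children sat_branches[OF node.prems])
  have nonneg: "W c \<ge> 0" if "c \<in> children (plabel \<psi> n)" for c
    using that by (rule weight_nonneg[OF children_in_pnodes[OF node.hyps]])
  show ?case
  proof (cases "plabel \<psi> n")
    case TrueLeaf
    then show ?thesis using weight[OF node.hyps] by simp
  next
    case FalseLeaf
    then show ?thesis using not_sat_FalseLeaf node.prems by metis
  next
    case (Conjunction C)
    then show ?thesis using weight[OF node.hyps] pos by (auto intro: prod_pos)
  next
    case (Decision x h l a b)
    then show ?thesis
      using weight[OF node.hyps] pos nonneg Decision_params[OF node.hyps Decision]
      by (cases "\<tau> x") (auto intro: add_nonneg_pos add_pos_nonneg)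
  qed
qed

text \<open>At a decision node the numerator contains the weight of the followed child, which
  cancels against the denominator in the induction hypothesis; at a conjunction the denominators
  multiply to \<open>W n\<close>.\<close>

lemma prod_branch_prob:
  assumes "n \<in> pnodes \<psi>" "sat \<psi> \<tau> n"
  shows "(\<Prod>m\<in>Rep_decisions \<psi> \<tau> n. branch_prob W \<tau> (plabel \<psi> m)) =
    (\<Prod>m\<in>Rep_decisions \<psi> \<tau> n. branch_param \<tau> (plabel \<psi> m)) / W n"
  using assms
proof (induction rule: node_induct)
  case (node n)
  have IH: "(\<Prod>m\<in>Rep_decisions \<psi> \<tau> c. branch_prob W \<tau> (plabel \<psi> m)) =
      (\<Prod>m\<in>Rep_decisions \<psi> \<tau> c. branch_param \<tau> (plabel \<psi> m)) / W c"
    if "c \<in> branches \<tau> (plabel \<psi> n)" for c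
    using that by (intro node.IH branches_children sat_branches[OF node.prems])
  have fin: "finite (Rep_decisions \<psi> \<tau> c)" if "c \<in> branches \<tau> (plabel \<psi> n)" for c
    using that by (rule finite_Rep_decisions[OF branches_in_pnodes[OF node.hyps]])
  note unfold = Rep_decisions_unfold[of \<psi> \<tau> n]
  show ?case
  proof (cases "plabel \<psi> n")
    case TrueLeaf
    then show ?thesis using weight[OF node.hyps] unfold by simp
  next
    case FalseLeaf
    then show ?thesis using not_sat_FalseLeaf node.prems by metis
  next
    case (Conjunction C)
    \<comment> \<open>A decision node below two conjuncts would put its variable into both of their
      disjoint variable sets.\<close>
    have disj: "Rep_decisions \<psi> \<tau> c \<inter> Rep_decisions \<psi> \<tau> d = {}" if "c \<in> C" "d \<in> C" "c \<noteq> d" for c d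
    proof -
      have "c \<in> pnodes \<psi>" "d \<in> pnodes \<psi>"
        using that Conjunction by (simp_all add: children_in_pnodes[OF node.hyps])
      then show ?thesis
        using Conjunction_vars_disjoint[OF node.hyps Conjunction that] Rep_decisions_vars by blast
    qed
    have finC: "finite C"
      using finite_children[OF node.hyps] Conjunction by simp
    have split: "(\<Prod>m\<in>Rep_decisions \<psi> \<tau> n. f m) = (\<Prod>c\<in>C. \<Prod>m\<in>Rep_decisions \<psi> \<tau> c. f m)"
      for f :: "'n \<Rightarrow> real"
      using unfold Conjunction fin disj finC by (simp add: prod.UNION_disjoint)
    show ?thesis
      using IH weight[OF node.hyps] Conjunction by (simp add: split prod_dividef[symmetric])
  next
    case (Decision x h l a b)
    define c where "c = (if \<tau> x then h else l)"
    have c: "c \<in> branches \<tau> (plabel \<psi> n)"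
      by (simp add: c_def Decision)
    \<comment> \<open>Positivity is what permits the cancellation of \<open>W c\<close>.\<close>
    then have "W c > 0"
      by (intro weight_pos[of _ \<tau>] branches_in_pnodes[OF node.hyps] sat_branches[OF node.prems])
    have split: "(\<Prod>m\<in>Rep_decisions \<psi> \<tau> n. f m) = f n * (\<Prod>m\<in>Rep_decisions \<psi> \<tau> c. f m)"
      for f :: "'n \<Rightarrow> real"
      using unfold Decision fin[OF c] not_in_Rep_decisions_branch[OF node.hyps c]
      by (simp add: c_def)
    have "branch_prob W \<tau> (plabel \<psi> n) = branch_param \<tau> (plabel \<psi> n) * W c / W n"
      using weight[OF node.hyps] Decision by (simp add: c_def)
    then show ?thesis
      using IH[OF c] \<open>W c > 0\<close> by (simp add: split)
  qed
qed

end

lemma prob_bind_pmf: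
  "measure_pmf.prob (bind_pmf M f) A = (\<integral>x. measure_pmf.prob (f x) A \<partial>M)"
  unfolding measure_pmf_bind
  by (rule measure_pmf.measure_bind[where N = "count_space UNIV"]) (auto simp: measure_subprob)

section \<open>Runs of ProbSample\<close>

text \<open>The form of \<open>bottom_up\<close> suited to induction on the list: \<open>D\<close>
  collects the nodes processed so far.\<close>

fun processable :: "('n, 'x) prob_dag \<Rightarrow> 'n set \<Rightarrow> 'n list \<Rightarrow> bool" where
  "processable \<psi> D [] \<longleftrightarrow> True"
| "processable \<psi> D (n # ns) \<longleftrightarrow>
     n \<notin> D \<and> children (plabel \<psi> n) \<subseteq> D \<and> processable \<psi> (insert n D) ns"

definition children_closed :: "('n, 'x) prob_dag \<Rightarrow> 'n set \<Rightarrow> bool" where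
  "children_closed \<psi> D \<longleftrightarrow> (\<forall>n\<in>D. children (plabel \<psi> n) \<subseteq> D)"

text \<open>A run seen without its order: each entry can be judged against the same state because
  its inputs are not overwritten after being read.\<close>

definition consistent :: "('n, 'x) prob_dag \<Rightarrow> 'n set \<Rightarrow> ('n, 'x) sampler_state \<Rightarrow> bool" where
  "consistent \<psi> D st \<longleftrightarrow> (\<forall>n\<in>D. st n \<in> set_pmf (process_node (plabel \<psi> n) st))"

text \<open>An invalid sample agrees with no assignment, whereas a partial sample may leave
  variables open.\<close>

definition agrees :: "('x \<Rightarrow> bool) \<Rightarrow> 'x partial_sample \<Rightarrow> bool" where
  "agrees \<tau> \<omega> \<longleftrightarrow> (\<exists>L. \<omega> = Some L \<and> (\<forall>(x, b)\<in>L. b = \<tau> x))"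

lemma agrees_literals: "agrees \<tau> (Some ((\<lambda>x. (x, \<tau> x)) ` X))"
  by (auto simp: agrees_def)

lemma processableI:
  assumes "distinct ns" "set ns \<inter> D = {}"
    "\<forall>i<length ns. children (plabel \<psi> (ns ! i)) \<subseteq> D \<union> set (take i ns)"
  shows "processable \<psi> D ns"
  using assms
proof (induction ns arbitrary: D)
  case (Cons n ns)
  have "children (plabel \<psi> (ns ! i)) \<subseteq> insert n D \<union> set (take i ns)" if "i < length ns" for i
    using Cons.prems(3)[rule_format, of "Suc i"] that by simp
  then show ?case
    using Cons.IH[of "insert n D"] Cons.prems Cons.prems(3)[rule_format, of 0] by auto
qed simp

lemma processable_disjoint: "processable \<psi> D ns \<Longrightarrow> set ns \<inter> D = {}"
  by (induction ns arbitrary: D) auto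

lemma bottom_up_processable: "bottom_up \<psi> ns \<Longrightarrow> processable \<psi> {} ns"
  by (rule processableI) (auto simp: bottom_up_def)

lemma consistent_process_nodes:
  assumes "consistent \<psi> D st" "children_closed \<psi> D" "processable \<psi> D ns"
    "st' \<in> set_pmf (process_nodes \<psi> ns st)"
  shows "consistent \<psi> (D \<union> set ns) st'"
  using assms
proof (induction ns arbitrary: D st)
  case (Cons n ns)
  obtain r where r: "r \<in> set_pmf (process_node (plabel \<psi> n) st)"
    "st' \<in> set_pmf (process_nodes \<psi> ns (st(n := r)))"
    using Cons.prems by auto
  \<comment> \<open>The children of \<open>m\<close> lie in \<open>D\<close> and \<open>n\<close>
    does not, so writing \<open>n\<close> leaves the inputs of \<open>m\<close> unchanged.\<close>
  have cong: "process_node (plabel \<psi> m) (st(n := r)) = process_node (plabel \<psi> m) st"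
    if "m \<in> insert n D" for m
    using that Cons.prems by (intro process_node_cong) (auto simp: children_closed_def)
  have "consistent \<psi> (insert n D) (st(n := r))"
    unfolding consistent_def using cong r(1) Cons.prems by (auto simp: consistent_def)
  moreover have "children_closed \<psi> (insert n D)"
    using Cons.prems by (auto simp: children_closed_def)
  ultimately have "consistent \<psi> (insert n D \<union> set ns) st'"
    by (rule Cons.IH[OF _ _ _ r(2)]) (use Cons.prems(3) in simp)
  then show ?case by simp
qed simp

text \<open>The literals of a followed child are contained in those of its parent. At a decision
  node the literal inserted for \<open>x\<close> matches \<tau> only if the coin selected the child
  that \<tau> follows.\<close>

lemma consistent_branches_agree:
  assumes st: "consistent \<psi> D st" and n: "n \<in> D" and agr: "agrees \<tau> (fst (st n))"
    and c: "c \<in> branches \<tau> (plabel \<psi> n)"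
  shows "agrees \<tau> (fst (st c))"
proof -
  have r: "st n \<in> set_pmf (process_node (plabel \<psi> n) st)"
    using st n by (simp add: consistent_def)
  show ?thesis
  proof (cases "plabel \<psi> n")
    case (Conjunction C)
    then have "fst (st n) = union_samples ((\<lambda>c. fst (st c)) ` C)"
      using r by simp
    with agr obtain L where "None \<notin> (\<lambda>c. fst (st c)) ` C" "L = \<Union> (the ` (\<lambda>c. fst (st c)) ` C)"
      "\<forall>(x, b)\<in>L. b = \<tau> x"
      by (auto simp: agrees_def union_samples_def split: if_splits)
    moreover obtain L' where "fst (st c) = Some L'"
      using c Conjunction calculation(1) by (cases "fst (st c)") force+
    ultimately show ?thesis
      using c Conjunction unfolding agrees_def by fastforce
  next
    case (Decision x h l a b)
    then show ?thesis
      using r agr c by (auto simp: agrees_def Let_def split: if_splits)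
  qed (use c in auto)
qed

section \<open>Finished runs and the assignments they agree with\<close>

context PROB
begin

lemma consistent_Rep_agree:
  assumes st: "consistent \<psi> (pnodes \<psi>) st" and root: "agrees \<tau> (fst (st (proot \<psi>)))"
    and n: "n \<in> Rep \<psi> \<tau>"
  shows "agrees \<tau> (fst (st n))"
  using n
proof induction
  case 1
  show ?case by (rule root)
next
  case (2 n C c)
  then show ?case
    using consistent_branches_agree[OF st, of n \<tau> c] Rep_subset_pnodes by auto
next
  case (3 n x h l a b)
  then have "(if \<tau> x then h else l) \<in> branches \<tau> (plabel \<psi> n)"
    by simp
  with 3 show ?case
    using Rep_subset_pnodes by (blast intro: consistent_branches_agree[OF st])
qed

text \<open>Agreement passes down the branches of \<tau>, where it excludes false leaves because
  their samples are invalid.\<close>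

lemma consistent_agree_sat:
  assumes st: "consistent \<psi> (pnodes \<psi>) st" and n: "n \<in> pnodes \<psi>" and agr: "agrees \<tau> (fst (st n))"
  shows "sat \<psi> \<tau> n"
  using n agr
proof (induction rule: node_induct)
  case (node n)
  have "plabel \<psi> n \<noteq> FalseLeaf"
    using st node by (force simp: consistent_def agrees_def)
  then show ?case
  proof (rule satI)
    fix c assume "c \<in> branches \<tau> (plabel \<psi> n)"
    then show "sat \<psi> \<tau> c"
      by (intro node.IH branches_children consistent_branches_agree[OF st node.hyps node.prems])
  qed
qed

text \<open>Only the selected child of a decision node contributes literals; by smoothness it has
  the same variables as the other child, so none is missed.\<close>

lemma consistent_agree_literals:
  assumes st: "consistent \<psi> (pnodes \<psi>) st" and smooth: "smooth \<psi>"
    and n: "n \<in> pnodes \<psi>" and agr: "agrees \<tau> (fst (st n))"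
  shows "fst (st n) = Some ((\<lambda>x. (x, \<tau> x)) ` vars \<psi> n)"
  using n agr
proof (induction rule: node_induct)
  case (node n)
  have r: "st n \<in> set_pmf (process_node (plabel \<psi> n) st)"
    using st node by (simp add: consistent_def)
  have IH: "fst (st c) = Some ((\<lambda>x. (x, \<tau> x)) ` vars \<psi> c)" if "c \<in> branches \<tau> (plabel \<psi> n)" for c
    using that by (intro node.IH branches_children consistent_branches_agree[OF st node.hyps node.prems])
  note unfold = vars_unfold[OF node.hyps]
  show ?case
  proof (cases "plabel \<psi> n")
    case TrueLeaf
    then show ?thesis using r unfold by simp
  next
    case FalseLeaf
    then show ?thesis using r node.prems by (simp add: agrees_def)
  next
    case (Conjunction C)
    then have "(\<lambda>c. fst (st c)) ` C = (\<lambda>c. Some ((\<lambda>x. (x, \<tau> x)) ` vars \<psi> c)) ` C"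
      using IH by (intro image_cong) auto
    then show ?thesis
      using Conjunction r unfold by (auto simp: union_samples_def image_image)
  next
    case (Decision x h l a b)
    then have "vars \<psi> h = vars \<psi> l"
      using smooth node.hyps by (force simp: smooth_def)
    then show ?thesis
      using Decision r unfold IH node.prems by (auto simp: Let_def agrees_def split: if_splits)
  qed
qed

end

section \<open>Probability that a run agrees with a solution\<close>

context weighted_PROB
begin

text \<open>Since the followed children already agree, agreement of \<open>n\<close> depends only on
  its own coin flip.\<close>

lemma prob_process_node_agrees:
  assumes n: "n \<in> pnodes \<psi>" and sat: "sat \<psi> \<tau> n"
    and wt: "\<And>c. c \<in> children (plabel \<psi> n) \<Longrightarrow> snd (st c) = W c"
    and agr: "\<And>c. c \<in> branches \<tau> (plabel \<psi> n) \<Longrightarrow> agrees \<tau> (fst (st c))"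
  shows "measure_pmf.prob (process_node (plabel \<psi> n) st) {r. agrees \<tau> (fst r)} =
    branch_prob W \<tau> (plabel \<psi> n)"
proof (cases "plabel \<psi> n")
  case TrueLeaf
  then show ?thesis by (simp add: agrees_def)
next
  case FalseLeaf
  then show ?thesis using not_sat_FalseLeaf sat by metis
next
  case (Conjunction C)
  have "None \<notin> (\<lambda>c. fst (st c)) ` C"
    using agr Conjunction by (force simp: agrees_def)
  moreover have "b = \<tau> x" if "c \<in> C" "(x, b) \<in> the (fst (st c))" for c x b
    using agr[of c] that Conjunction by (auto simp: agrees_def)
  ultimately have "agrees \<tau> (union_samples ((\<lambda>c. fst (st c)) ` C))"
    by (auto simp: agrees_def union_samples_def)
  then show ?thesis
    using Conjunction by simp
next
  case (Decision x h l a b)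
  have nonneg: "W h \<ge> 0" "W l \<ge> 0"
    using Decision by (simp_all add: weight_nonneg children_in_pnodes[OF n])
  have ab: "a > 0" "b > 0"
    using Decision_params[OF n Decision] by auto
  \<comment> \<open>The denominator is the weight of \<open>n\<close>, positive because
    \<open>n\<close> is satisfied; hence \<open>p\<close> below is a genuine coin bias.\<close>
  have pos: "b * W l + a * W h > 0"
    using weight_pos[OF n sat] weight[OF n] Decision by simp
  define p where "p = a * W h / (b * W l + a * W h)"
  have p: "0 \<le> p" "p \<le> 1" "1 - p = b * W l / (b * W l + a * W h)"
    using nonneg ab pos by (auto simp: p_def field_simps)
  have wts: "snd (st h) = W h" "snd (st l) = W l"
    using wt Decision by auto
  have "measure_pmf.prob (process_node (plabel \<psi> n) st) {r. agrees \<tau> (fst r)} =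
    measure_pmf.prob (bernoulli_pmf p)
      {c. agrees \<tau> (if c then map_option (insert (x, True)) (fst (st h))
                    else map_option (insert (x, False)) (fst (st l)))}"
    by (simp add: Decision wts Let_def p_def vimage_def)
  \<comment> \<open>The inserted literal rules out the other outcome, and the followed child agrees
    by assumption, so exactly the outcome \<open>\<tau> x\<close> remains.\<close>
  also have "{c. agrees \<tau> (if c then map_option (insert (x, True)) (fst (st h))
                    else map_option (insert (x, False)) (fst (st l)))} = {\<tau> x}"
    using agr Decision by (auto simp: agrees_def split: if_splits)
  also have "measure_pmf.prob (bernoulli_pmf p) {\<tau> x} = branch_prob W \<tau> (plabel \<psi> n)"
    using p Decision by (cases "\<tau> x") (simp_all add: measure_pmf_single, simp add: p_def)
  finally show ?thesis .
qed

text \<open>Independence of the branches, as an induction over the processing order. Entries in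
  \<open>D\<close> are fixed, so their agreement is a factor 0 or 1; each node of \<open>Rep\<close>
  still to come contributes its branch probability, whatever happens outside
  \<open>Rep\<close>.\<close>

lemma prob_process_nodes_agree:
  assumes sat: "sat \<psi> \<tau> (proot \<psi>)"
    and "children_closed \<psi> D" "processable \<psi> D ns" "set ns \<subseteq> pnodes \<psi>"
    and "\<And>n. n \<in> D \<Longrightarrow> snd (st n) = W n"
  shows "measure_pmf.prob (process_nodes \<psi> ns st)
      {st'. \<forall>n\<in>Rep \<psi> \<tau> \<inter> (D \<union> set ns). agrees \<tau> (fst (st' n))} =
    of_bool (\<forall>n\<in>Rep \<psi> \<tau> \<inter> D. agrees \<tau> (fst (st n))) *
      (\<Prod>n\<in>Rep \<psi> \<tau> \<inter> set ns. branch_prob W \<tau> (plabel \<psi> n))"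
  using assms(2-)
proof (induction ns arbitrary: D st)
  case Nil
  then show ?case by (simp add: indicator_def)
next
  case (Cons n ns)
  let ?P = "\<Prod>n\<in>Rep \<psi> \<tau> \<inter> set ns. branch_prob W \<tau> (plabel \<psi> n)"
  let ?good = "\<lambda>D st. \<forall>n\<in>Rep \<psi> \<tau> \<inter> D. agrees \<tau> (fst (st n))"
  let ?M = "process_node (plabel \<psi> n) st"
  have n: "n \<in> pnodes \<psi>" "n \<notin> D" "children (plabel \<psi> n) \<subseteq> D" and fresh: "n \<notin> set ns"
    using Cons.prems processable_disjoint[of \<psi> "insert n D" ns] by auto
  have IH: "measure_pmf.prob (process_nodes \<psi> ns (st(n := r)))
      {st'. ?good (D \<union> set (n # ns)) st'} = of_bool (?good (insert n D) (st(n := r))) * ?P"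
    if "r \<in> set_pmf ?M" for r
  proof -
    have "snd r = W n"
      using snd_process_node[OF that] weight[OF n(1)] n(3) Cons.prems(4)
        node_weight_cong[of "plabel \<psi> n" "\<lambda>n. snd (st n)" W] by auto
    then have "\<And>m. m \<in> insert n D \<Longrightarrow> snd ((st(n := r)) m) = W m"
      using Cons.prems(4) by auto
    moreover have "children_closed \<psi> (insert n D)"
      using Cons.prems(1) n(3) by (auto simp: children_closed_def)
    ultimately have "measure_pmf.prob (process_nodes \<psi> ns (st(n := r)))
      {st'. ?good (insert n D \<union> set ns) st'} = of_bool (?good (insert n D) (st(n := r))) * ?P"
      using Cons.prems(2,3) by (intro Cons.IH) simp_all
    moreover have "insert n D \<union> set ns = D \<union> set (n # ns)"
      by simp
    ultimately show ?thesis
      by (simp only:)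
  qed
  \<comment> \<open>As \<open>n\<close> lies outside \<open>D\<close>, its result \<open>r\<close>
    leaves the condition on \<open>D\<close> untouched.\<close>
  have good: "?good (insert n D) (st(n := r)) \<longleftrightarrow> ?good D st \<and> (n \<in> Rep \<psi> \<tau> \<longrightarrow> agrees \<tau> (fst r))" for r
    using n(2) by auto
  have "measure_pmf.prob (process_nodes \<psi> (n # ns) st) {st'. ?good (D \<union> set (n # ns)) st'} =
    (\<integral>r. measure_pmf.prob (process_nodes \<psi> ns (st(n := r))) {st'. ?good (D \<union> set (n # ns)) st'} \<partial>?M)"
    by (simp only: process_nodes.simps prob_bind_pmf)
  \<comment> \<open>On the support of \<open>?M\<close> the integrand depends on \<open>r\<close>
    only through one indicator, so the other factors leave the integral.\<close>
  also have "\<dots> = (\<integral>r. indicator {r. n \<in> Rep \<psi> \<tau> \<longrightarrow> agrees \<tau> (fst r)} r * (of_bool (?good D st) * ?P) \<partial>?M)"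
  proof (rule integral_cong_AE)
    have "measure_pmf.prob (process_nodes \<psi> ns (st(n := r))) {st'. ?good (D \<union> set (n # ns)) st'} =
        indicator {r. n \<in> Rep \<psi> \<tau> \<longrightarrow> agrees \<tau> (fst r)} r * (of_bool (?good D st) * ?P)"
      if "r \<in> set_pmf ?M" for r
      unfolding IH[OF that] good by (simp add: indicator_def)
    then show "AE r in ?M. measure_pmf.prob (process_nodes \<psi> ns (st(n := r))) {st'. ?good (D \<union> set (n # ns)) st'} =
        indicator {r. n \<in> Rep \<psi> \<tau> \<longrightarrow> agrees \<tau> (fst r)} r * (of_bool (?good D st) * ?P)"
      unfolding AE_measure_pmf_iff by blast
  qed simp_all
  also have "\<dots> = measure_pmf.prob ?M {r. n \<in> Rep \<psi> \<tau> \<longrightarrow> agrees \<tau> (fst r)} * (of_bool (?good D st) * ?P)"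
    by simp
  \<comment> \<open>If the condition on \<open>D\<close> fails, both sides vanish; if
    \<open>n\<close> is not visited, its event is certain and no factor is added.\<close>
  also have "\<dots> = of_bool (?good D st) * (\<Prod>n\<in>Rep \<psi> \<tau> \<inter> set (n # ns). branch_prob W \<tau> (plabel \<psi> n))"
  proof (cases "n \<in> Rep \<psi> \<tau> \<and> ?good D st")
    case True
    then have "measure_pmf.prob ?M {r. agrees \<tau> (fst r)} = branch_prob W \<tau> (plabel \<psi> n)"
    proof (intro prob_process_node_agrees)
      show "snd (st c) = W c" if "c \<in> children (plabel \<psi> n)" for c
        using that n(3) Cons.prems(4) by blast
      \<comment> \<open>A followed child of a visited node is itself visited, and it lies in
        \<open>D\<close> because children are processed first.\<close>
      show "agrees \<tau> (fst (st c))" if "c \<in> branches \<tau> (plabel \<psi> n)" for c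
        using True Rep_branches[OF _ that] branches_children[OF that] n(3) by blast
    qed (use True n sat_Rep[OF sat] in simp_all)
    then show ?thesis
      using True fresh by simp
  qed (use fresh in auto)
  finally show ?case .
qed

end

section \<open>The distribution of the sampled assignment\<close>

lemma assignment_of_eq_Some_iff:
  "assignment_of X L = Some \<tau> \<longleftrightarrow> \<tau> \<in> X \<rightarrow>\<^sub>E UNIV \<and> L = (\<lambda>x. (x, \<tau> x)) ` X"
proof
  assume "assignment_of X L = Some \<tau>"
  then have \<tau>: "\<tau> = (\<lambda>x\<in>X. (x, True) \<in> L)" and "L = (\<lambda>x. (x, (\<lambda>x\<in>X. (x, True) \<in> L) x)) ` X"
    unfolding assignment_of_def Let_def by (simp_all only: option.inject option.distinct split: if_splits)
  note this(2)[folded \<tau>]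
  moreover have "\<tau> \<in> X \<rightarrow>\<^sub>E UNIV"
    unfolding \<tau> by simp
  ultimately show "\<tau> \<in> X \<rightarrow>\<^sub>E UNIV \<and> L = (\<lambda>x. (x, \<tau> x)) ` X"
    by (rule conjI[rotated])
next
  assume *: "\<tau> \<in> X \<rightarrow>\<^sub>E UNIV \<and> L = (\<lambda>x. (x, \<tau> x)) ` X"
  \<comment> \<open>Outside \<open>X\<close> both sides are \<open>undefined\<close>.\<close>
  have "(\<lambda>x\<in>X. (x, True) \<in> L) x = \<tau> x" for x
    using PiE_arb[OF conjunct1[OF *], of x] unfolding conjunct2[OF *] by (cases "x \<in> X") auto
  then have "(\<lambda>x\<in>X. (x, True) \<in> L) = \<tau>"
    by (rule ext)
  then show "assignment_of X L = Some \<tau>"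
    unfolding assignment_of_def Let_def using conjunct2[OF *] by (simp only: if_True refl)
qed

lemma finite_Sol: "finite X \<Longrightarrow> finite (Sol X (F :: _ \<Rightarrow> bool))"
  by (rule finite_subset[of _ "X \<rightarrow>\<^sub>E UNIV"]) (auto simp: Sol_def intro: finite_PiE)

locale bottom_up_PROB = PROB \<psi> for \<psi> :: "('n, 'x) prob_dag" +
  fixes ns :: "'n list"
  assumes bottom_up: "bottom_up \<psi> ns"
begin

definition final_state :: "('n, 'x) sampler_state pmf" where
  "final_state = process_nodes \<psi> ns (\<lambda>_. (None, 0))"

definition sampled_assignment :: "'x set \<Rightarrow> ('x \<Rightarrow> bool) option pmf" where
  "sampled_assignment X = map_pmf (\<lambda>\<omega>. Option.bind \<omega> (assignment_of X)) (ProbSample \<psi> ns)"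

lemma sampled_assignment_eq:
  "sampled_assignment X =
     map_pmf (\<lambda>st. Option.bind (fst (st (proot \<psi>))) (assignment_of X)) final_state"
  by (simp add: sampled_assignment_def ProbSample_def final_state_def map_pmf_comp)

lemma consistent_final_state: "st \<in> set_pmf final_state \<Longrightarrow> consistent \<psi> (pnodes \<psi>) st"
  using consistent_process_nodes[of \<psi> "{}" _ ns st] bottom_up bottom_up_processable[OF bottom_up]
  by (auto simp: consistent_def children_closed_def final_state_def bottom_up_def)

text \<open>Some final state is possible, since a pmf has nonempty support, and by consistency its
  weights satisfy the recursion.\<close>

lemma weights_exist: "\<exists>W. weighted_PROB \<psi> W"
proof -
  obtain st where "st \<in> set_pmf final_state"
    using set_pmf_not_empty[of final_state] by blast
  then have "consistent \<psi> (pnodes \<psi>) st"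
    by (rule consistent_final_state)
  then have "weighted_PROB \<psi> (\<lambda>n. snd (st n))"
    by unfold_locales (auto simp: consistent_def dest: snd_process_node)
  then show ?thesis by (rule exI[of "weighted_PROB \<psi>"])
qed

lemma sampled_assignment_sat:
  assumes "Some \<tau> \<in> set_pmf (sampled_assignment X)"
  shows "\<tau> \<in> Sol X (\<lambda>\<tau>. sat \<psi> \<tau> (proot \<psi>))"
proof -
  obtain st where st: "st \<in> set_pmf final_state"
    and bind: "Option.bind (fst (st (proot \<psi>))) (assignment_of X) = Some \<tau>"
    using assms by (auto simp: sampled_assignment_eq)
  then have "\<tau> \<in> X \<rightarrow>\<^sub>E UNIV" "agrees \<tau> (fst (st (proot \<psi>)))"
    using agrees_literals by (auto simp: bind_eq_Some_conv assignment_of_eq_Some_iff)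
  then show ?thesis
    using consistent_agree_sat[OF consistent_final_state[OF st] proot_in_pnodes]
    by (simp add: Sol_def)
qed

lemma pmf_sampled_assignment:
  assumes W: "weighted_PROB \<psi> W" and smooth: "smooth \<psi>" and X: "vars \<psi> (proot \<psi>) = X"
    and \<tau>: "\<tau> \<in> Sol X (\<lambda>\<tau>. sat \<psi> \<tau> (proot \<psi>))"
  shows "pmf (sampled_assignment X) (Some \<tau>) =
    (\<Prod>n\<in>{n \<in> Rep \<psi> \<tau>. is_Decision (plabel \<psi> n)}. branch_param \<tau> (plabel \<psi> n)) / W (proot \<psi>)"
proof -
  interpret weighted_PROB \<psi> W by (rule W)
  have sat: "sat \<psi> \<tau> (proot \<psi>)" and ext: "\<tau> \<in> X \<rightarrow>\<^sub>E UNIV"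
    using \<tau> by (auto simp: Sol_def)
  have nodes: "set ns = pnodes \<psi>"
    using bottom_up by (simp add: bottom_up_def)
  \<comment> \<open>By smoothness a root sample that agrees with \<tau> has a literal for every
    variable of \<open>X\<close>, so it decodes to \<tau> itself. The union with the empty set
    matches the state in which no node is processed yet.\<close>
  have event: "Option.bind (fst (st (proot \<psi>))) (assignment_of X) = Some \<tau> \<longleftrightarrow>
      (\<forall>n\<in>Rep \<psi> \<tau> \<inter> ({} \<union> set ns). agrees \<tau> (fst (st n)))" if "st \<in> set_pmf final_state" for st
  proof -
    note cons = consistent_final_state[OF that]
    have "Option.bind (fst (st (proot \<psi>))) (assignment_of X) = Some \<tau> \<longleftrightarrow> agrees \<tau> (fst (st (proot \<psi>)))"
      using consistent_agree_literals[OF cons smooth proot_in_pnodes] agrees_literals ext X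
      by (auto simp: bind_eq_Some_conv assignment_of_eq_Some_iff)
    also have "\<dots> \<longleftrightarrow> (\<forall>n\<in>Rep \<psi> \<tau> \<inter> ({} \<union> set ns). agrees \<tau> (fst (st n)))"
      using consistent_Rep_agree[OF cons] proot_in_pnodes nodes by (auto intro: Rep.intros)
    finally show ?thesis .
  qed
  have "pmf (sampled_assignment X) (Some \<tau>) =
    measure_pmf.prob final_state {st. Option.bind (fst (st (proot \<psi>))) (assignment_of X) = Some \<tau>}"
    by (simp add: sampled_assignment_eq pmf_map vimage_def)
  \<comment> \<open>The two events are equivalent for possible final states, hence almost
    surely.\<close>
  also have "\<dots> = measure_pmf.prob final_state {st. \<forall>n\<in>Rep \<psi> \<tau> \<inter> ({} \<union> set ns). agrees \<tau> (fst (st n))}"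
    by (intro measure_pmf.finite_measure_eq_AE) (auto simp: AE_measure_pmf_iff event)
  also have "\<dots> = (\<Prod>n\<in>Rep \<psi> \<tau> \<inter> set ns. branch_prob W \<tau> (plabel \<psi> n))"
    unfolding final_state_def
    using prob_process_nodes_agree[OF sat _ bottom_up_processable[OF bottom_up], of "\<lambda>_. (None, 0)"] nodes
    by (simp add: children_closed_def)
  also have "\<dots> = (\<Prod>n\<in>Rep_decisions \<psi> \<tau> (proot \<psi>). branch_prob W \<tau> (plabel \<psi> n))"
  proof (rule prod.mono_neutral_right)
    show "finite (Rep \<psi> \<tau> \<inter> set ns)" by simp
    show "Rep_decisions \<psi> \<tau> (proot \<psi>) \<subseteq> Rep \<psi> \<tau> \<inter> set ns"
      using Rep_subset_pnodes nodes by (auto simp: Rep_decisions_def Rep_eq_Rep_from)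
    show "\<forall>n\<in>Rep \<psi> \<tau> \<inter> set ns - Rep_decisions \<psi> \<tau> (proot \<psi>). branch_prob W \<tau> (plabel \<psi> n) = 1"
    proof
      fix n assume "n \<in> Rep \<psi> \<tau> \<inter> set ns - Rep_decisions \<psi> \<tau> (proot \<psi>)"
      then have "\<not> is_Decision (plabel \<psi> n)"
        by (simp add: Rep_decisions_def Rep_eq_Rep_from)
      then show "branch_prob W \<tau> (plabel \<psi> n) = 1"
        by (cases "plabel \<psi> n") auto
    qed
  qed
  also have "\<dots> = (\<Prod>n\<in>Rep_decisions \<psi> \<tau> (proot \<psi>). branch_param \<tau> (plabel \<psi> n)) / W (proot \<psi>)"
    by (rule prod_branch_prob[OF proot_in_pnodes sat])
  finally show ?thesis
    by (simp add: Rep_decisions_def Rep_eq_Rep_from)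
qed

end

text \<open>A variable missing below the root is detected by flipping it in the solution \<tau>.
  Without a solution, the root may be a bare false leaf with no variables.\<close>

lemma vars_root_eq:
  assumes PROB: "is_PROB \<psi>" and G: "ugraph V E" and rep: "represents \<psi> (trip_vars V) (relaxed_encoding V E)"
    and \<tau>: "\<tau> \<in> Sol (trip_vars V) (relaxed_encoding V E)"
  shows "vars \<psi> (proot \<psi>) = trip_vars V"
proof (rule ccontr)
  interpret PROB \<psi>
    using PROB by unfold_locales
  assume "vars \<psi> (proot \<psi>) \<noteq> trip_vars V"
  then obtain x where x: "x \<in> trip_vars V" "x \<notin> vars \<psi> (proot \<psi>)"
    using rep by (auto simp: represents_def)
  have Sol: "Sol (trip_vars V) (\<lambda>\<tau>. sat \<psi> \<tau> (proot \<psi>)) = Sol (trip_vars V) (relaxed_encoding V E)"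
    using rep by (simp add: represents_def)
  let ?\<tau>' = "\<tau>(x := \<not> \<tau> x)"
  have "sat \<psi> \<tau> (proot \<psi>)"
    using \<tau> unfolding Sol[symmetric] by (simp add: Sol_def)
  then have "sat \<psi> ?\<tau>' (proot \<psi>)"
  proof (rule sat_cong[OF proot_in_pnodes, rotated])
    show "\<tau> y = ?\<tau>' y" if "y \<in> vars \<psi> (proot \<psi>)" for y
      using that x(2) by auto
  qed
  moreover have "?\<tau>' \<in> trip_vars V \<rightarrow>\<^sub>E UNIV"
    using \<tau> x by (auto simp: Sol_def PiE_def extensional_def)
  ultimately have "?\<tau>' \<in> Sol (trip_vars V) (relaxed_encoding V E)"
    unfolding Sol[symmetric] by (simp add: Sol_def)
  then show False
    using relaxed_encoding_flip[OF G _ x(1)] \<tau> by (auto simp: Sol_def)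
qed

section \<open>The distribution of the sampled trip\<close>

theorem theorem1:
  fixes V :: "'v set" and E :: "'v set set"
    and \<psi> :: "('n, 'v trip_var) prob_dag" and ns :: "'n list"
  assumes "ugraph V E"
    and "is_PROB \<psi>" and "smooth \<psi>"
    and "represents \<psi> (trip_vars V) (relaxed_encoding V E)"
    and "bottom_up \<psi> ns"
  shows "\<exists>C>0. \<forall>v\<^sub>s\<in>V. \<forall>v\<^sub>t\<in>V. \<forall>\<pi>. simple_trip V E \<pi> \<and> Term \<pi> = {v\<^sub>s, v\<^sub>t} \<longrightarrow>
    measure_pmf.prob (sample_trip V E \<psi> ns) {Some (traversals \<pi>)} =
    C * (\<Sum>\<tau>\<in>R V E \<pi>. \<Prod>n\<in>{n \<in> Rep \<psi> \<tau>. is_Decision (plabel \<psi> n)}.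
           let I = of_bool (hi (plabel \<psi> n) \<in> Rep \<psi> \<tau>)
           in (1 - I) * theta_lo (plabel \<psi> n) + I * theta_hi (plabel \<psi> n))"
proof -
  interpret bottom_up_PROB \<psi> ns
    using assms by unfold_locales
  let ?X = "trip_vars V"
  let ?Sol = "Sol ?X (relaxed_encoding V E)"
  obtain W where W: "weighted_PROB \<psi> W"
    using weights_exist by blast
  have Sol: "Sol ?X (\<lambda>\<tau>. sat \<psi> \<tau> (proot \<psi>)) = ?Sol"
    using assms(4) by (simp add: represents_def)
  have sat: "sat \<psi> \<tau> (proot \<psi>)" if "\<tau> \<in> ?Sol" for \<tau>
    using that unfolding Sol[symmetric] by (simp add: Sol_def)
  have "finite ?X"
    using assms(1) by (simp add: ugraph_def trip_vars_def)
  \<comment> \<open>One constant serves all trips. Without solutions the root weight may be zero,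
    but then both sides of the claim are zero and any positive constant does.\<close>
  define C where "C = (if ?Sol = {} then 1 else 1 / W (proot \<psi>))"
  have "C > 0"
    using weighted_PROB.weight_pos[OF W proot_in_pnodes] sat by (auto simp: C_def)
  let ?weight = "\<lambda>\<tau>. \<Prod>n\<in>{n \<in> Rep \<psi> \<tau>. is_Decision (plabel \<psi> n)}.
           let I = of_bool (hi (plabel \<psi> n) \<in> Rep \<psi> \<tau>)
           in (1 - I) * theta_lo (plabel \<psi> n) + I * theta_hi (plabel \<psi> n)"
  have branch_weight: "pmf (sampled_assignment ?X) (Some \<tau>) = C * ?weight \<tau>" if \<tau>: "\<tau> \<in> ?Sol" for \<tau>
  proof -
    have "?weight \<tau> =
        (\<Prod>n\<in>{n \<in> Rep \<psi> \<tau>. is_Decision (plabel \<psi> n)}. branch_param \<tau> (plabel \<psi> n))"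
    proof (rule prod.cong[OF refl])
      fix n assume "n \<in> {n \<in> Rep \<psi> \<tau>. is_Decision (plabel \<psi> n)}"
      then have n: "n \<in> Rep \<psi> \<tau>" and "is_Decision (plabel \<psi> n)" by auto
      then obtain x h l a b where "plabel \<psi> n = Decision x h l a b"
        by (cases "plabel \<psi> n") auto
      \<comment> \<open>Membership of the true child in \<open>Rep\<close> coincides with the value
        of the decision variable, so the indicator selects the parameter of the branch
        taken.\<close>
      then show "(let I = of_bool (hi (plabel \<psi> n) \<in> Rep \<psi> \<tau>)
           in (1 - I) * theta_lo (plabel \<psi> n) + I * theta_hi (plabel \<psi> n)) =
           branch_param \<tau> (plabel \<psi> n)"
        using hi_in_Rep_iff[OF sat[OF \<tau>] n] by simp
    qed
    moreover have "pmf (sampled_assignment ?X) (Some \<tau>) =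
        (\<Prod>n\<in>{n \<in> Rep \<psi> \<tau>. is_Decision (plabel \<psi> n)}. branch_param \<tau> (plabel \<psi> n)) / W (proot \<psi>)"
      using pmf_sampled_assignment[OF W assms(3) vars_root_eq[OF assms(2,1,4) \<tau>]] \<tau>
      by (simp only: Sol)
    moreover have "C = 1 / W (proot \<psi>)"
      using \<tau> by (auto simp: C_def)
    ultimately show ?thesis
      by (simp only: times_divide_eq_left mult_1_left)
  qed
  have "measure_pmf.prob (sample_trip V E \<psi> ns) {Some (traversals \<pi>)} = C * (\<Sum>\<tau>\<in>R V E \<pi>. ?weight \<tau>)" for \<pi>
  proof -
    have R: "R V E \<pi> \<subseteq> ?Sol" "finite (R V E \<pi>)"
      using finite_Sol[OF \<open>finite ?X\<close>] by (auto simp: R_def intro: finite_subset)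
    have "measure_pmf.prob (sample_trip V E \<psi> ns) {Some (traversals \<pi>)} =
      measure_pmf.prob (sampled_assignment ?X) {\<omega>. map_option (refine V E) \<omega> = Some (traversals \<pi>)}"
      by (simp add: sample_trip_def sampled_assignment_def vimage_def)
    \<comment> \<open>Every sampled assignment is a solution, so refining to the traversals of \<pi>
      amounts to membership in \<open>R V E \<pi>\<close> almost surely.\<close>
    also have "\<dots> = measure_pmf.prob (sampled_assignment ?X) (Some ` R V E \<pi>)"
    proof (rule measure_pmf.finite_measure_eq_AE)
      have "map_option (refine V E) \<omega> = Some (traversals \<pi>) \<longleftrightarrow> \<omega> \<in> Some ` R V E \<pi>"
        if "\<omega> \<in> set_pmf (sampled_assignment ?X)" for \<omega>
        using sampled_assignment_sat[of _ ?X] that unfolding Sol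
        by (cases \<omega>) (auto simp: R_def)
      then show "AE \<omega> in sampled_assignment ?X.
          \<omega> \<in> {\<omega>. map_option (refine V E) \<omega> = Some (traversals \<pi>)} \<longleftrightarrow> \<omega> \<in> Some ` R V E \<pi>"
        by (simp add: AE_measure_pmf_iff)
    qed simp_all
    also have "\<dots> = (\<Sum>\<tau>\<in>R V E \<pi>. pmf (sampled_assignment ?X) (Some \<tau>))"
      using R(2) by (simp add: measure_measure_pmf_finite sum.reindex)
    also have "\<dots> = (\<Sum>\<tau>\<in>R V E \<pi>. C * ?weight \<tau>)"
      using R(1) by (intro sum.cong[OF refl] branch_weight) blast
    finally show ?thesis
      by (simp only: sum_distrib_left)
  qed
  then show ?thesis
    using \<open>C > 0\<close> by blast
qed

end
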